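(* Let $(S,+,\ell)$ be an adequate partial layered semigroup with $\delta$ layers and let $\mathcal F$ be a locally finite collection of regressive maps on $S$. Suppose $S$ is $\mathcal F$-Ramsey, and let $n<\delta$ and $m\in\mathbb N$. Then for any finite colouring of $S$ there exists a block sequence $(x_1,\dots,x_m)\subseteq S_n$ of length $m$ such that for every $k\le n$ the set $$S_k\cap\big\{f_1(x_{n_1})+\cdots+f_\ell(x_{n_\ell}):\ n_1<\cdots<n_\ell\le m,\ f_1,\dots,f_\ell\in\mathcal F\big\}$$ is monochromatic.
   Context: Nonstandard framework: a universe with a star map $M\mapsto{}^*M$ (iterable: ${}^{*k}M$) satisfying the usual properties (${}^*A\supseteq\{{}^*x:x\in A\}$ for sets, monotonicity, ${}^*(A^k)=({}^*A)^k$, functions extend to their stars, ${}^*s=s$ for $s\in S$, ${}^*n=n$ for $n\in\mathbb N$) and the transfer principle for bounded-quantifier formulas; the nonstandard universe is assumed saturated enough that ${}^*S$ is compact in the topology generated by the sets ${}^*B$, $B\subseteq S$. Extensions of $+$ and of maps $f$ are denoted by the same symbols. For $\alpha\in{}^{*m}S$ let $\mathcal U_\alpha=\{B\subseteq S:\alpha\in{}^{*m}B\}$; $\alpha\sim\beta$ iff $\mathcal U_\alpha=\mathcal U_\beta$. Write $\alpha\preccurlyeq\beta$ iff $\alpha+{}^*\beta\sim\beta+{}^*\alpha\sim\alpha$. An adequate partial layered semigroup is a partial semigroup $(S,+)$ with $\ell:S\to\mathbb N$ whose range is an initial segment of $\mathbb N$ of size $\delta\in\mathbb N\cup\{\omega\}$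 (the number of layers), layers $S_i=\ell^{-1}(i)$, $S_{\le i}=\ell^{-1}(\{0,\dots,i\})$, such that $\ell(s+t)=\max\{\ell(s),\ell(t)\}$ whenever $s+t$ is defined, and for all $s_1,\dots,s_n\in S_i$ there is $t\in S_i$ with all $s_j+t$ defined. For $B\subseteq S$, ${}^\gamma B=\{\alpha\in{}^*B: x+\alpha$ defined for all $x\in B\}$; $\Pi_S=\prod_{i<\delta}{}^\gamma S_i$. A regressive map is $f:S\to S$ with: $f(s+t)=f(s)+f(t)$; $\ell(f(s))\le\ell(s)$; $\ell(s)\le\ell(t)\Rightarrow\ell(f(s))\le\ell(f(t))$; $|\ell(f(s))-\ell(f(t))|\le|\ell(s)-\ell(t)|$. $\mathcal F$ is locally finite if each $\{f|_{S_{\le i}}:f\in\mathcal F\}$ is finite. $(\alpha_i)_{i<\delta}\in\Pi_S$ is $\mathcal F$-coherent if for all $f\in\mathcal F$, $j<\delta$ there is $k\le j$ with $f(\alpha_j)\sim\alpha_k$; it is $\mathcal F$-Ramsey if moreover $\alpha_j\preccurlyeq\alpha_i$ for all $i\le j<\delta$. $S$ is $\mathcal F$-Ramsey if $\Pi_S$ contains an $\mathcal F$-Ramsey element. A finite sequence $(x_1,\dots,x_m)$ in $S$ is a block sequence if for all indices $n_0<\cdots<n_{\ell-1}$ and $f_0,\dots,f_{\ell-1}\in\mathcal F$ the sum $f_0(x_{n_0})+\cdots+f_{\ell-1}(x_{n_{\ell-1}})$ is defined. *)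

theory Defs
  imports "HOL-Analysis.Analysis" "HOL-Library.Extended_Nat"
begin

section \<open>Nonstandard universes\<close>

text \<open>
  A universe has a single type of objects (individuals and sets alike), with its own membership
  relation, ordered pairs and numerals, and a star map from the universe to itself, which can
  therefore be iterated.
\<close>

record 'u universe =
  mem :: "'u \<Rightarrow> 'u \<Rightarrow> bool"
  opair :: "'u \<Rightarrow> 'u \<Rightarrow> 'u"
  num :: "nat \<Rightarrow> 'u"
  star :: "'u \<Rightarrow> 'u"

definition elems :: "'u universe \<Rightarrow> 'u \<Rightarrow> 'u set" where
  "elems U a = {x. mem U x a}"

definition set_of_universe :: "'u universe \<Rightarrow> 'u set \<Rightarrow> bool" where
  "set_of_universe U A \<longleftrightarrow> (\<exists>a. elems U a = A)"

text \<open>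
  Bounded-quantifier formulas with named variables. \<open>FEx x y \<phi>\<close> stands for
  \<open>\<exists>x \<in> y. \<phi>\<close>, and \<open>FPair x y z\<close> for \<open>x = (y, z)\<close>.
  The latter is an atom so that no particular set-theoretic coding of pairs is imposed.
  Parameters enter through the assignment.
\<close>

datatype bounded_formula =
    FMem nat nat
  | FEq nat nat
  | FPair nat nat nat
  | FNot bounded_formula
  | FAnd bounded_formula bounded_formula
  | FEx nat nat bounded_formula

primrec sat :: "'u universe \<Rightarrow> (nat \<Rightarrow> 'u) \<Rightarrow> bounded_formula \<Rightarrow> bool" where
  "sat U e (FMem x y) \<longleftrightarrow> mem U (e x) (e y)"
| "sat U e (FEq x y) \<longleftrightarrow> e x = e y"
| "sat U e (FPair x y z) \<longleftrightarrow> e x = opair U (e y) (e z)"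
| "sat U e (FNot \<phi>) \<longleftrightarrow> \<not> sat U e \<phi>"
| "sat U e (FAnd \<phi> \<psi>) \<longleftrightarrow> sat U e \<phi> \<and> sat U e \<psi>"
| "sat U e (FEx x y \<phi>) \<longleftrightarrow> (\<exists>v. mem U v (e y) \<and> sat U (e(x := v)) \<phi>)"

text \<open>
  Only the closure properties needed to speak about sets, finitary relations and functions are
  required; every superstructure with a star map into itself is an instance. Objects without
  elements (individuals and the empty set) are not identified. The other usual properties of
  the star map (monotonicity, compatibility with finite products, extension of functions to
  functions) are instances of transfer.
\<close>

locale nonstandard_universe =
  fixes U :: "'u universe"
  assumes extensionality:
      "\<And>a b. elems U a = elems U b \<Longrightarrow> elems U a \<noteq> {} \<Longrightarrow> a = b"
    and opair_inject:
      "\<And>x y x' y'. opair U x y = opair U x' y' \<Longrightarrow> x = x' \<and> y = y'"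
    and subsets:
      "\<And>A B. set_of_universe U A \<Longrightarrow> B \<subseteq> A \<Longrightarrow> set_of_universe U B"
    and products:
      "\<And>A B. set_of_universe U A \<Longrightarrow> set_of_universe U B \<Longrightarrow>
         set_of_universe U {opair U x y | x y. x \<in> A \<and> y \<in> B}"
    and naturals: "inj (num U)" "set_of_universe U (range (num U))"
    and star_num: "\<And>n. star U (num U n) = num U n"
    and transfer_principle: "\<And>\<phi> e. sat U e \<phi> \<longleftrightarrow> sat U (star U \<circ> e) \<phi>"

text \<open>
  The \<open>k\<close>-fold hyperextension of a set of the universe, as a set of objects. The choice of
  the object with elements \<open>A\<close> matters only for \<open>A = {}\<close>, and there it does not affect
  the result, by transfer.
\<close>

definition hyper :: "'u universe \<Rightarrow> nat \<Rightarrow> 'u set \<Rightarrow> 'u set" where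
  "hyper U k A = elems U ((star U ^^ k) (SOME a. elems U a = A))"


section \<open>Layered partial semigroups\<close>

text \<open>
  The value \<open>None\<close> of \<open>add\<close> means that the sum is undefined. Only the restrictions of
  \<open>add\<close> and \<open>lev\<close> to the carrier are relevant.
\<close>

record 's layered =
  carrier :: "'s set"
  add :: "'s \<Rightarrow> 's \<Rightarrow> 's option"
  lev :: "'s \<Rightarrow> nat"

text \<open>Associativity: if one of the two sides is defined, so is the other, and they are equal.\<close>

definition partial_semigroup :: "'s layered \<Rightarrow> bool" where
  "partial_semigroup P \<longleftrightarrow>
     (\<forall>s\<in>carrier P. \<forall>t\<in>carrier P. \<forall>u. add P s t = Some u \<longrightarrow> u \<in> carrier P) \<and>
     (\<forall>s\<in>carrier P. \<forall>t\<in>carrier P. \<forall>u\<in>carrier P.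
        Option.bind (add P s t) (\<lambda>v. add P v u) = Option.bind (add P t u) (\<lambda>v. add P s v))"

definition layer :: "'s layered \<Rightarrow> nat \<Rightarrow> 's set" where
  "layer P i = {s \<in> carrier P. lev P s = i}"

definition layers_upto :: "'s layered \<Rightarrow> nat \<Rightarrow> 's set" where
  "layers_upto P i = {s \<in> carrier P. lev P s \<le> i}"

definition adequate_layered :: "'s layered \<Rightarrow> enat \<Rightarrow> bool" where
  "adequate_layered P \<delta> \<longleftrightarrow>
     partial_semigroup P \<and>
     lev P ` carrier P = {i. enat i < \<delta>} \<and>
     (\<forall>s\<in>carrier P. \<forall>t\<in>carrier P. \<forall>u.
        add P s t = Some u \<longrightarrow> lev P u = max (lev P s) (lev P t)) \<and>
     (\<forall>i. enat i < \<delta> \<longrightarrow>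
        (\<forall>A. finite A \<and> A \<subseteq> layer P i \<longrightarrow> (\<exists>t\<in>layer P i. \<forall>s\<in>A. add P s t \<noteq> None)))"

definition regressive :: "'s layered \<Rightarrow> ('s \<Rightarrow> 's) \<Rightarrow> bool" where
  "regressive P f \<longleftrightarrow>
     f \<in> carrier P \<rightarrow> carrier P \<and>
     (\<forall>s\<in>carrier P. \<forall>t\<in>carrier P. \<forall>u.
        add P s t = Some u \<longrightarrow> add P (f s) (f t) = Some (f u)) \<and>
     (\<forall>s\<in>carrier P. lev P (f s) \<le> lev P s) \<and>
     (\<forall>s\<in>carrier P. \<forall>t\<in>carrier P. lev P s \<le> lev P t \<longrightarrow> lev P (f s) \<le> lev P (f t)) \<and>
     (\<forall>s\<in>carrier P. \<forall>t\<in>carrier P.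
        \<bar>int (lev P (f s)) - int (lev P (f t))\<bar> \<le> \<bar>int (lev P s) - int (lev P t)\<bar>)"

definition locally_finite :: "'s layered \<Rightarrow> ('s \<Rightarrow> 's) set \<Rightarrow> bool" where
  "locally_finite P F \<longleftrightarrow> (\<forall>i. finite {restrict f (layers_upto P i) | f. f \<in> F})"


section \<open>Extension of the operations, coherent and Ramsey sequences\<close>

definition add_graph :: "'u universe \<Rightarrow> 'u layered \<Rightarrow> 'u set" where
  "add_graph U P = {opair U (opair U s t) u | s t u.
     s \<in> carrier P \<and> t \<in> carrier P \<and> add P s t = Some u}"

definition map_graph :: "'u universe \<Rightarrow> 'u layered \<Rightarrow> ('u \<Rightarrow> 'u) \<Rightarrow> 'u set" where
  "map_graph U P f = {opair U s (f s) | s. s \<in> carrier P}"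

text \<open>The extensions of addition and of a map to the \<open>k\<close>-fold hyperextension of the carrier.\<close>

definition hyper_add :: "'u universe \<Rightarrow> 'u layered \<Rightarrow> nat \<Rightarrow> 'u \<Rightarrow> 'u \<Rightarrow> 'u option" where
  "hyper_add U P k x y =
     (if \<exists>z. opair U (opair U x y) z \<in> hyper U k (add_graph U P)
      then Some (THE z. opair U (opair U x y) z \<in> hyper U k (add_graph U P))
      else None)"

definition hyper_map :: "'u universe \<Rightarrow> 'u layered \<Rightarrow> nat \<Rightarrow> ('u \<Rightarrow> 'u) \<Rightarrow> 'u \<Rightarrow> 'u" where
  "hyper_map U P k f x = (THE y. opair U x y \<in> hyper U k (map_graph U P f))"

text \<open>\<open>ultra U P k \<alpha>\<close> is \<open>\<U>\<^sub>\<alpha>\<close> for \<open>\<alpha>\<close> in the \<open>k\<close>-fold hyperextension of the carrier.\<close>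

definition ultra :: "'u universe \<Rightarrow> 'u layered \<Rightarrow> nat \<Rightarrow> 'u \<Rightarrow> 'u set set" where
  "ultra U P k \<alpha> = {B. B \<subseteq> carrier P \<and> \<alpha> \<in> hyper U k B}"

definition sim :: "'u universe \<Rightarrow> 'u layered \<Rightarrow> nat \<Rightarrow> 'u \<Rightarrow> nat \<Rightarrow> 'u \<Rightarrow> bool" where
  "sim U P k \<alpha> l \<beta> \<longleftrightarrow> ultra U P k \<alpha> = ultra U P l \<beta>"

text \<open>
  For \<open>\<alpha>\<close> and \<open>\<beta>\<close> in the first hyperextension. When the star map fixes the elements of the
  carrier, the first hyperextension is contained in the second one, where the two sums
  are formed; both must be defined.
\<close>

definition preceq :: "'u universe \<Rightarrow> 'u layered \<Rightarrow> 'u \<Rightarrow> 'u \<Rightarrow> bool" where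
  "preceq U P \<alpha> \<beta> \<longleftrightarrow>
     (\<exists>\<sigma> \<tau>. hyper_add U P 2 \<alpha> (star U \<beta>) = Some \<sigma> \<and>
            hyper_add U P 2 \<beta> (star U \<alpha>) = Some \<tau> \<and>
            sim U P 2 \<sigma> 2 \<tau> \<and> sim U P 2 \<tau> 1 \<alpha>)"

definition gamma :: "'u universe \<Rightarrow> 'u layered \<Rightarrow> 'u set \<Rightarrow> 'u set" where
  "gamma U P B = {\<alpha> \<in> hyper U 1 B. \<forall>x\<in>B. hyper_add U P 1 x \<alpha> \<noteq> None}"

definition PiS :: "'u universe \<Rightarrow> 'u layered \<Rightarrow> enat \<Rightarrow> (nat \<Rightarrow> 'u) set" where
  "PiS U P \<delta> = (\<Pi>\<^sub>E i\<in>{i. enat i < \<delta>}. gamma U P (layer P i))"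

definition coherent ::
  "'u universe \<Rightarrow> 'u layered \<Rightarrow> enat \<Rightarrow> ('u \<Rightarrow> 'u) set \<Rightarrow> (nat \<Rightarrow> 'u) \<Rightarrow> bool" where
  "coherent U P \<delta> F \<alpha> \<longleftrightarrow>
     (\<forall>f\<in>F. \<forall>j. enat j < \<delta> \<longrightarrow> (\<exists>k\<le>j. sim U P 1 (hyper_map U P 1 f (\<alpha> j)) 1 (\<alpha> k)))"

definition ramsey_sequence ::
  "'u universe \<Rightarrow> 'u layered \<Rightarrow> enat \<Rightarrow> ('u \<Rightarrow> 'u) set \<Rightarrow> (nat \<Rightarrow> 'u) \<Rightarrow> bool" where
  "ramsey_sequence U P \<delta> F \<alpha> \<longleftrightarrow>
     coherent U P \<delta> F \<alpha> \<and>
     (\<forall>i j. i \<le> j \<and> enat j < \<delta> \<longrightarrow> preceq U P (\<alpha> j) (\<alpha> i))"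

definition ramsey ::
  "'u universe \<Rightarrow> 'u layered \<Rightarrow> enat \<Rightarrow> ('u \<Rightarrow> 'u) set \<Rightarrow> bool" where
  "ramsey U P \<delta> F \<longleftrightarrow> (\<exists>\<alpha>\<in>PiS U P \<delta>. ramsey_sequence U P \<delta> F \<alpha>)"


section \<open>Block sequences\<close>

text \<open>
  The sum of a nonempty list, bracketed to the left; by associativity the bracketing affects
  neither definedness nor the value.
\<close>

fun list_sum :: "'s layered \<Rightarrow> 's list \<Rightarrow> 's option" where
  "list_sum P [] = None"
| "list_sum P (x # xs) = foldl (\<lambda>a y. Option.bind a (\<lambda>s. add P s y)) (Some x) xs"

text \<open>
  The lists of summands \<open>[f\<^sub>1 x\<^bsub>n\<^sub>1\<^esub>, \<dots>, f\<^sub>l x\<^bsub>n\<^sub>l\<^esub>]\<close> with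
  \<open>l \<ge> 1\<close> and \<open>n\<^sub>1 < \<dots> < n\<^sub>l\<close>; positions in \<open>xs\<close> are counted from 0.
\<close>

definition summands :: "('s \<Rightarrow> 's) set \<Rightarrow> 's list \<Rightarrow> 's list set" where
  "summands F xs = {map2 (\<lambda>f n. f (xs ! n)) fs ns | fs ns.
     ns \<noteq> [] \<and> length fs = length ns \<and> set fs \<subseteq> F \<and>
     sorted_wrt (<) ns \<and> set ns \<subseteq> {..<length xs}}"

definition block_sequence :: "'s layered \<Rightarrow> ('s \<Rightarrow> 's) set \<Rightarrow> 's list \<Rightarrow> bool" where
  "block_sequence P F xs \<longleftrightarrow>
     set xs \<subseteq> carrier P \<and> (\<forall>ys\<in>summands F xs. list_sum P ys \<noteq> None)"

definition block_sums :: "'s layered \<Rightarrow> ('s \<Rightarrow> 's) set \<Rightarrow> 's list \<Rightarrow> 's set" where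
  "block_sums P F xs = {s. \<exists>ys\<in>summands F xs. list_sum P ys = Some s}"

definition monochromatic :: "('s \<Rightarrow> 'c) \<Rightarrow> 's set \<Rightarrow> bool" where
  "monochromatic c A \<longleftrightarrow> (\<exists>d. \<forall>x\<in>A. c x = d)"

end

theory Submission
  imports Defs
begin

text \<open>
  The types of \<open>\<alpha>\<^sub>0, \<dots>, \<alpha>\<^sub>n\<close> are ultrafilters \<open>W\<^sub>0, \<dots>, W\<^sub>n\<close> on \<open>S\<close>.
  For \<open>i \<le> j\<close>, \<open>\<alpha>\<^sub>j \<preceq> \<alpha>\<^sub>i\<close> says that the convolution of \<open>W\<^sub>i\<close> and \<open>W\<^sub>j\<close>, in either
  order, is \<open>W\<^sub>j\<close>, and coherence says that each \<open>f \<in> F\<close> pushes \<open>W\<^sub>n\<close> forward to some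
  \<open>W\<^sub>k\<close>. Given colour classes \<open>A\<^sub>k \<in> W\<^sub>k\<close>, almost every \<open>x\<close> for \<open>W\<^sub>n\<close> satisfies,
  for each \<open>f\<close> pushing \<open>W\<^sub>n\<close> to \<open>W\<^sub>i\<close>, both \<open>f x \<in> A\<^sub>i\<close> and
  \<open>{y. f x + y \<in> A\<^bsub>max i k\<^esub>} \<in> W\<^sub>k\<close> for all \<open>k \<le> n\<close>. By local finiteness one
  \<open>x\<close> serves all \<open>f\<close>; take it as the first term, shrink every \<open>A\<^sub>k\<close> to the \<open>y\<close> with
  \<open>f x + y \<in> A\<^bsub>max i k\<^esub>\<close> for all \<open>f\<close>, and repeat.
\<close>

section \<open>Sums along block sequences\<close>

lemma partial_semigroup_closed:
  assumes "partial_semigroup P" "s \<in> carrier P" "t \<in> carrier P" "add P s t = Some u"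
  shows "u \<in> carrier P"
  using assms unfolding partial_semigroup_def by blast

lemma partial_semigroup_assoc:
  assumes "partial_semigroup P" "s \<in> carrier P" "t \<in> carrier P" "u \<in> carrier P"
  shows "Option.bind (add P s t) (\<lambda>v. add P v u) = Option.bind (add P t u) (add P s)"
  using assms unfolding partial_semigroup_def by blast

lemma list_sum_snoc:
  "xs \<noteq> [] \<Longrightarrow> list_sum P (xs @ [y]) = Option.bind (list_sum P xs) (\<lambda>s. add P s y)"
  by (cases xs) auto

lemma list_sum_closed:
  assumes "partial_semigroup P" "set xs \<subseteq> carrier P" "list_sum P xs = Some s"
  shows "s \<in> carrier P"
  using assms(2,3)
proof (induction xs arbitrary: s rule: rev_induct)
  case (snoc y xs)
  show ?case
  proof (cases "xs = []")
    case True
    then show ?thesis using snoc.prems by simp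
  next
    case False
    then obtain t where "list_sum P xs = Some t" "add P t y = Some s"
      using snoc.prems(2) by (auto simp: list_sum_snoc bind_eq_Some_conv)
    moreover from this have "t \<in> carrier P"
      using snoc by simp
    ultimately show ?thesis
      using partial_semigroup_closed[OF assms(1), of t y s] snoc.prems(1) by simp
  qed
qed simp

text \<open>\<open>list_sum\<close> brackets to the left, whereas the construction puts new terms in
  front. Associativity rebrackets, by induction from the right end.\<close>

lemma list_sum_Cons:
  assumes "partial_semigroup P" "x \<in> carrier P" "set ys \<subseteq> carrier P" "ys \<noteq> []"
  shows "list_sum P (x # ys) = Option.bind (list_sum P ys) (add P x)"
  using assms(3,4)
proof (induction ys rule: rev_induct)
  case (snoc y ys)
  show ?case
  proof (cases "ys = []")
    case False
    have "list_sum P (x # ys @ [y]) = Option.bind (list_sum P (x # ys)) (\<lambda>s. add P s y)"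
      using list_sum_snoc[of "x # ys"] by simp
    also have "list_sum P (x # ys) = Option.bind (list_sum P ys) (add P x)"
      using snoc.prems(1) by (intro snoc.IH False) simp
    \<comment> \<open>With \<open>s\<close> the sum of \<open>ys\<close>, the two sides are (x + s)
      + y and x + (s + y); partial associativity equates definedness as well as value.\<close>
    also have "Option.bind \<dots> (\<lambda>s. add P s y) =
        Option.bind (Option.bind (list_sum P ys) (\<lambda>s. add P s y)) (add P x)"
    proof (cases "list_sum P ys")
      case (Some s)
      have "s \<in> carrier P"
        using list_sum_closed[OF assms(1) _ Some] snoc.prems(1) by simp
      then show ?thesis
        unfolding Some Option.bind.simps
        using snoc.prems(1) by (intro partial_semigroup_assoc assms(1,2)) simp_all
    qed simp
    also have "Option.bind (list_sum P ys) (\<lambda>s. add P s y) = list_sum P (ys @ [y])"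
      using False by (rule list_sum_snoc[symmetric])
    finally show ?thesis .
  qed simp
qed simp

section \<open>Splitting off the first term of a sequence\<close>

lemma summands_nonempty: "ys \<in> summands F xs \<Longrightarrow> ys \<noteq> []"
  by (auto simp: summands_def)

lemma summands_subset:
  assumes "ys \<in> summands F xs" "\<And>f x. f \<in> F \<Longrightarrow> x \<in> set xs \<Longrightarrow> f x \<in> A"
  shows "set ys \<subseteq> A"
proof -
  obtain fs ns where ys: "ys = map2 (\<lambda>f n. f (xs ! n)) fs ns"
    and *: "set fs \<subseteq> F" "set ns \<subseteq> {..<length xs}"
    using assms(1) by (auto simp: summands_def)
  have "f (xs ! n) \<in> A" if "(f, n) \<in> set (zip fs ns)" for f n
  proof (rule assms(2)[of f "xs ! n"])
    show "f \<in> F" using set_zip_leftD[OF that] *(1) by blast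
    show "xs ! n \<in> set xs" using set_zip_rightD[OF that] *(2) by auto
  qed
  then show ?thesis by (auto simp: ys)
qed

text \<open>All positions are at least 1, so each can be lowered by one. The new list
  \<open>ms\<close> depends on \<open>ns\<close> alone, hence the equation holds for every
  \<open>fs\<close>.\<close>

lemma map2_nth_Cons:
  fixes xs :: "'a list"
  assumes "set ns \<subseteq> {..<Suc (length xs)}" "sorted_wrt (<) ns" "0 \<notin> set ns"
  obtains ms where "set ms \<subseteq> {..<length xs}" "sorted_wrt (<) ms" "length ms = length ns"
    "\<And>fs :: ('a \<Rightarrow> 'b) list. map2 (\<lambda>f n. f ((x # xs) ! n)) fs ns = map2 (\<lambda>f n. f (xs ! n)) fs ms"
proof -
  define ms where "ms = map (\<lambda>i. i - 1) ns"
  have ns: "ns = map Suc ms"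
    using assms(3) by (auto simp: ms_def comp_def intro!: map_idI[symmetric] Suc_pred gr0I)
  show thesis
  proof (rule that[of ms])
    show "set ms \<subseteq> {..<length xs}" "sorted_wrt (<) ms" "length ms = length ns"
      using assms(1,2) by (auto simp: ns sorted_wrt_map)
    show "map2 (\<lambda>f n. f ((x # xs) ! n)) fs ns = map2 (\<lambda>f n. f (xs ! n)) fs ms" for fs
      by (simp add: ns zip_map2 case_prod_unfold)
  qed
qed

text \<open>Positions increase strictly, so 0 can only come first. The cases are 0 alone, 0 followed
  by further positions, and 0 absent.\<close>

lemma summands_ConsE:
  fixes F :: "('s \<Rightarrow> 's) set"
  assumes "ys \<in> summands F (x # xs)"
  obtains f where "f \<in> F" "ys = [f x]"
  | f zs where "f \<in> F" "zs \<in> summands F xs" "ys = f x # zs"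
  | "ys \<in> summands F xs"
proof -
  obtain fs ns where ys: "ys = map2 (\<lambda>f n. f ((x # xs) ! n)) fs ns"
    and ne: "ns \<noteq> []" "length fs = length ns" "set fs \<subseteq> F"
    and ns: "sorted_wrt (<) ns" "set ns \<subseteq> {..<Suc (length xs)}"
    using assms by (auto simp: summands_def)
  show thesis
  proof (cases "0 \<in> set ns")
    case False
    obtain ms where "set ms \<subseteq> {..<length xs}" "sorted_wrt (<) ms" "length ms = length ns"
      "\<And>fs :: ('s \<Rightarrow> 's) list. map2 (\<lambda>f n. f ((x # xs) ! n)) fs ns = map2 (\<lambda>f n. f (xs ! n)) fs ms"
      by (rule map2_nth_Cons[OF ns(2,1) False]) (rule that)
    then have "ys \<in> summands F xs"
      unfolding summands_def using ys ne by (auto intro!: exI[of _ fs] exI[of _ ms])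
    then show thesis by (rule that(3))
  next
    case True
    then obtain ns' where ns': "ns = 0 # ns'"
      using ns(1) by (cases ns) auto
    obtain f fs' where fs: "fs = f # fs'"
      using ne ns' by (cases fs) auto
    have "set ns' \<subseteq> {..<Suc (length xs)}" "sorted_wrt (<) ns'" "0 \<notin> set ns'"
      using ns by (auto simp: ns')
    then obtain ms where ms:
      "set ms \<subseteq> {..<length xs}" "sorted_wrt (<) ms" "length ms = length ns'"
      "\<And>fs :: ('s \<Rightarrow> 's) list. map2 (\<lambda>f n. f ((x # xs) ! n)) fs ns' = map2 (\<lambda>f n. f (xs ! n)) fs ms"
      by (rule map2_nth_Cons) (rule that)
    have f: "f \<in> F" using ne by (simp add: fs)
    show thesis
    proof (cases "ns' = []")
      case True
      then show thesis using that(1)[OF f] by (simp add: ys fs ns')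
    next
      case False
      then have "map2 (\<lambda>f n. f (xs ! n)) fs' ms \<in> summands F xs"
        unfolding summands_def using ne ms(1-3)
        by (auto simp: fs ns' intro!: exI[of _ fs'] exI[of _ ms])
      then show thesis
        using that(2)[OF f] ms(4)[of fs'] by (simp add: ys fs ns')
    qed
  qed
qed

text \<open>\<open>F\<close> may be infinite, but local finiteness leaves only finitely many
  restrictions to the layers up to a given one. This allows passing to those restrictions.\<close>

lemma summands_restrict:
  assumes "set xs \<subseteq> A"
  shows "summands F xs \<subseteq> summands ((\<lambda>f. restrict f A) ` F) xs"
proof
  fix ys assume "ys \<in> summands F xs"
  then obtain fs ns where ys: "ys = map2 (\<lambda>f n. f (xs ! n)) fs ns"
    and *: "ns \<noteq> []" "length fs = length ns" "set fs \<subseteq> F"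
      "sorted_wrt (<) ns" "set ns \<subseteq> {..<length xs}"
    by (auto simp: summands_def)
  have "xs ! n \<in> A" if "n \<in> set ns" for n
    using that assms *(5) nth_mem by blast
  then have "ys = map2 (\<lambda>f n. f (xs ! n)) (map (\<lambda>f. restrict f A) fs) ns"
    unfolding ys by (auto simp: zip_map1 case_prod_unfold dest!: set_zip_rightD)
  then show "ys \<in> summands ((\<lambda>f. restrict f A) ` F) xs"
    unfolding summands_def using *
    by (auto intro!: imageI exI[of _ "map (\<lambda>f. restrict f A) fs"] exI[of _ ns])
qed

text \<open>The construction in terms of filters alone. \<open>Q k\<close> plays the role of the
  class A_k and varies in the induction on \<open>m\<close>, because each new term shrinks it. The
  index \<open>max i j\<close> in \<open>conv\<close> expresses both orders of convolution at
  once.\<close>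

lemma block_sums_eventually:
  fixes W :: "nat \<Rightarrow> 's filter"
  assumes P: "partial_semigroup P"
    and G: "finite G" "\<And>g. g \<in> G \<Longrightarrow> g \<in> L \<rightarrow> carrier P"
    and L: "W n \<noteq> bot" "\<forall>\<^sub>F x in W n. x \<in> L"
    and push: "\<And>g. g \<in> G \<Longrightarrow> \<exists>k\<le>n. filtermap g (W n) \<le> W k"
    and conv: "\<And>i j Q. i \<le> n \<Longrightarrow> j \<le> n \<Longrightarrow> \<forall>\<^sub>F z in W (max i j). Q z \<Longrightarrow>
      \<forall>\<^sub>F x in W i. \<forall>\<^sub>F y in W j. \<exists>z. add P x y = Some z \<and> Q z"
    and Q: "\<And>k. k \<le> n \<Longrightarrow> \<forall>\<^sub>F x in W k. Q k x"
  shows "\<exists>xs. length xs = m \<and> set xs \<subseteq> L \<and>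
    (\<forall>ys\<in>summands G xs. \<exists>k\<le>n. \<exists>s. list_sum P ys = Some s \<and> Q k s)"
  using Q
proof (induction m arbitrary: Q)
  case 0
  then show ?case by (auto simp: summands_def)
next
  case (Suc m)
  obtain \<kappa> where \<kappa>: "\<And>g. g \<in> G \<Longrightarrow> \<kappa> g \<le> n" "\<And>g. g \<in> G \<Longrightarrow> filtermap g (W n) \<le> W (\<kappa> g)"
    using push by metis
  \<comment> \<open>The shrinking condition on \<open>y\<close>: a typical point of
    \<open>W (\<kappa> g)\<close> plus a typical point of \<open>W k\<close> must satisfy the
    predicate belonging to the larger index.\<close>
  let ?R = "\<lambda>g x k y. \<exists>z. add P (g x) y = Some z \<and> Q (max (\<kappa> g) k) z"
  have "\<forall>\<^sub>F x in W n. Q (\<kappa> g) (g x) \<and> (\<forall>k\<in>{..n}. \<forall>\<^sub>F y in W k. ?R g x k y)" if g: "g \<in> G" for g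
  proof -
    \<comment> \<open>First shown for almost every \<open>u\<close> with respect to
      \<open>W (\<kappa> g)\<close>, then pulled back along \<open>g\<close> to almost every
      \<open>x\<close> with respect to \<open>W n\<close>.\<close>
    have "\<forall>\<^sub>F u in W (\<kappa> g). Q (\<kappa> g) u \<and>
      (\<forall>k\<in>{..n}. \<forall>\<^sub>F y in W k. \<exists>z. add P u y = Some z \<and> Q (max (\<kappa> g) k) z)"
      using \<kappa>(1)[OF g] Suc.prems
      by (intro eventually_conj eventually_ball_finite ballI conv) auto
    from filter_leD[OF \<kappa>(2)[OF g] this] show ?thesis
      by (simp add: eventually_filtermap)
  qed
  then have "\<forall>\<^sub>F x in W n. x \<in> L \<and>
    (\<forall>g\<in>G. Q (\<kappa> g) (g x) \<and> (\<forall>k\<in>{..n}. \<forall>\<^sub>F y in W k. ?R g x k y))"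
    using L(2) G(1) by (intro eventually_conj eventually_ball_finite) auto
  from eventually_happens'[OF L(1) this] obtain x where x: "x \<in> L"
    "\<And>g. g \<in> G \<Longrightarrow> Q (\<kappa> g) (g x)"
    "\<And>g k. g \<in> G \<Longrightarrow> k \<le> n \<Longrightarrow> \<forall>\<^sub>F y in W k. ?R g x k y"
    by auto
  \<comment> \<open>The shrunken predicates still hold almost everywhere, so the induction
    hypothesis applies to them: any sum over the resulting \<open>xs\<close> may be preceded by any
    \<open>g x\<close>.\<close>
  have "\<forall>\<^sub>F y in W k. Q k y \<and> (\<forall>g\<in>G. ?R g x k y)" if "k \<le> n" for k
    using that x(3) Suc.prems G(1) by (intro eventually_conj eventually_ball_finite) auto
  from Suc.IH[OF this] obtain xs where xs: "length xs = m" "set xs \<subseteq> L"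
    "\<And>ys. ys \<in> summands G xs \<Longrightarrow>
       \<exists>k\<le>n. \<exists>s. list_sum P ys = Some s \<and> Q k s \<and> (\<forall>g\<in>G. ?R g x k s)"
    by blast
  have "\<exists>k\<le>n. \<exists>s. list_sum P ys = Some s \<and> Q k s" if "ys \<in> summands G (x # xs)" for ys
    using that
  proof (cases rule: summands_ConsE)
    case (1 f)
    then show ?thesis using x(2) \<kappa>(1) by auto
  next
    case (2 f zs)
    obtain k s where k: "k \<le> n" "list_sum P zs = Some s" "?R f x k s"
      using xs(3)[OF 2(2)] 2(1) by blast
    have "set zs \<subseteq> carrier P"
      using 2(2) by (rule summands_subset) (use G(2) xs(2) in blast)
    moreover have "f x \<in> carrier P"
      using G(2) 2(1) x(1) by blast
    ultimately have "list_sum P ys = add P (f x) s"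
      using list_sum_Cons[OF P] summands_nonempty[OF 2(2)] k(2) by (simp add: 2(3) del: list_sum.simps)
    then show ?thesis
      using k(1,3) \<kappa>(1)[OF 2(1)] by (metis max.bounded_iff)
  next
    case 3
    then show ?thesis using xs(3) by blast
  qed
  then show ?case
    using xs(1,2) x(1) by (intro exI[of _ "x # xs"]) auto
qed


section \<open>Transfer\<close>

definition FAll :: "nat \<Rightarrow> nat \<Rightarrow> bounded_formula \<Rightarrow> bounded_formula" where
  "FAll x y \<phi> = FNot (FEx x y (FNot \<phi>))"

definition FImp :: "bounded_formula \<Rightarrow> bounded_formula \<Rightarrow> bounded_formula" where
  "FImp \<phi> \<psi> = FNot (FAnd \<phi> (FNot \<psi>))"

lemma sat_FAll [simp]: "sat U e (FAll x y \<phi>) \<longleftrightarrow> (\<forall>v. mem U v (e y) \<longrightarrow> sat U (e(x := v)) \<phi>)"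
  by (simp add: FAll_def)

lemma sat_FImp [simp]: "sat U e (FImp \<phi> \<psi>) \<longleftrightarrow> (sat U e \<phi> \<longrightarrow> sat U e \<psi>)"
  by (simp add: FImp_def)

context nonstandard_universe
begin

lemma opair_eq_iff [simp]: "opair U x y = opair U x' y' \<longleftrightarrow> x = x' \<and> y = y'"
  using opair_inject by blast

lemma transfer_iterated: "sat U e \<phi> \<longleftrightarrow> sat U ((star U ^^ k) \<circ> e) \<phi>"
proof (induction k)
  case (Suc k)
  then show ?case
    using transfer_principle[of "(star U ^^ k) \<circ> e" \<phi>] by (simp add: comp_def)
qed (simp add: comp_def)

text \<open>The same choice as in \<open>hyper\<close>, named so that a set can be placed in an
  assignment as a parameter.\<close>

definition code :: "'u set \<Rightarrow> 'u" where
  "code A = (SOME a. elems U a = A)"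

lemma elems_code: "set_of_universe U A \<Longrightarrow> elems U (code A) = A"
  unfolding code_def set_of_universe_def by (rule someI_ex)

lemma mem_code: "set_of_universe U A \<Longrightarrow> mem U x (code A) \<longleftrightarrow> x \<in> A"
  using elems_code[of A] by (auto simp: elems_def)

lemma mem_hyper: "x \<in> hyper U k A \<longleftrightarrow> mem U x ((star U ^^ k) (code A))"
  by (simp add: hyper_def elems_def code_def)

lemma hyper_empty:
  assumes "set_of_universe U A"
  shows "hyper U k {} = {}"
proof -
  have "set_of_universe U {}" using subsets[OF assms] by simp
  \<comment> \<open>\<open>code {}\<close> may be any object without elements; having none is a
    bounded statement and survives the star.\<close>
  then show ?thesis
    using transfer_iterated[of "\<lambda>_. code {}" "FNot (FEx 0 1 (FMem 0 1))" k]
    by (auto simp: mem_hyper mem_code)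
qed

text \<open>A single transfer that yields monotonicity, closure under intersection (\<open>C\<close>
  = \<open>D\<close>) and the ultrafilter dichotomy (\<open>A\<close> = \<open>B\<close> the
  carrier, \<open>C\<close> and \<open>D\<close> complementary).\<close>

lemma hyper_Int_subset_Un:
  assumes "set_of_universe U A" "set_of_universe U B" "set_of_universe U C" "set_of_universe U D"
    and "A \<inter> B \<subseteq> C \<union> D"
  shows "hyper U k A \<inter> hyper U k B \<subseteq> hyper U k C \<union> hyper U k D"
  \<comment> \<open>Slot 1, the range of the quantifier, keeps the default
    \<open>code A\<close>.\<close>
  using transfer_iterated
      [of "(\<lambda>_. code A)(2 := code B, 3 := code C, 4 := code D)"
        "FAll 0 1 (FImp (FMem 0 2) (FImp (FNot (FMem 0 3)) (FMem 0 4)))" k] assms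
  by (auto simp: mem_hyper mem_code)

lemma hyper_mono:
  assumes "set_of_universe U B" "A \<subseteq> B"
  shows "hyper U k A \<subseteq> hyper U k B"
  using hyper_Int_subset_Un[of A A B B k] subsets[OF assms] assms by auto

lemma hyper_graph_subset:
  assumes "set_of_universe U X" "set_of_universe U Y" "set_of_universe U g"
    and "g \<subseteq> {opair U x y | x y. x \<in> X \<and> y \<in> Y}"
    and "opair U x y \<in> hyper U k g"
  shows "x \<in> hyper U k X \<and> y \<in> hyper U k Y"
proof -
  \<comment> \<open>Slot 3 keeps the default \<open>code X\<close>.\<close>
  have "sat U ((\<lambda>_. code X)(4 := code Y, 5 := code g)) (FAll 0 5 (FEx 1 3 (FEx 2 4 (FPair 0 1 2))))"
    using assms(4) by (force simp: mem_code assms(1-3))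
  then have "\<forall>p. mem U p ((star U ^^ k) (code g)) \<longrightarrow>
      (\<exists>x. mem U x ((star U ^^ k) (code X)) \<and> (\<exists>y. mem U y ((star U ^^ k) (code Y)) \<and> p = opair U x y))"
    by (subst (asm) transfer_iterated[where k = k]) simp
  then show ?thesis
    using assms(5) opair_inject by (metis mem_hyper)
qed

lemma hyper_graph_functional:
  assumes sets: "set_of_universe U X" "set_of_universe U Y" "set_of_universe U g"
    and sub: "g \<subseteq> {opair U x y | x y. x \<in> X \<and> y \<in> Y}"
    and func: "\<And>x y z. opair U x y \<in> g \<Longrightarrow> opair U x z \<in> g \<Longrightarrow> y = z"
    and "opair U x y \<in> hyper U k g" "opair U x z \<in> hyper U k g"
  shows "y = z"
proof -
  have "sat U ((\<lambda>_. code X)(6 := code Y, 7 := code g))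
    (FAll 0 5 (FAll 1 6 (FAll 2 6 (FAll 3 7 (FAll 4 7
      (FImp (FPair 3 0 1) (FImp (FPair 4 0 2) (FEq 1 2))))))))"
    using func by (simp add: mem_code sets)
  \<comment> \<open>The transferred sentence speaks only of members of the stars of
    \<open>X\<close>, \<open>Y\<close> and \<open>g\<close>; \<open>hyper_graph_subset\<close>
    supplies these bounds for \<open>x\<close>, \<open>y\<close> and \<open>z\<close>.\<close>
  then show ?thesis
    using assms(6,7) hyper_graph_subset[OF sets sub assms(6)] hyper_graph_subset[OF sets sub assms(7)]
    by (subst (asm) transfer_iterated[where k = k], simp add: mem_hyper) blast
qed

lemma hyper_graph_total:
  assumes sets: "set_of_universe U X" "set_of_universe U Y" "set_of_universe U g"
    and total: "\<And>x. x \<in> X \<Longrightarrow> \<exists>y\<in>Y. opair U x y \<in> g"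
    and x: "x \<in> hyper U k X"
  shows "\<exists>y. opair U x y \<in> hyper U k g"
proof -
  have "sat U ((\<lambda>_. code X)(4 := code Y, 5 := code g))
    (FAll 0 3 (FEx 1 4 (FEx 2 5 (FPair 2 0 1))))"
    using total by (force simp: mem_code sets)
  then show ?thesis
    using x by (subst (asm) transfer_iterated[where k = k]) (auto simp: mem_hyper)
qed

text \<open>For \<open>g\<close> the graph of f and \<open>E\<close> the preimage of
  \<open>B\<close>, this turns f(\<alpha>) \<in> *B into \<alpha> \<in> *E.\<close>

lemma hyper_graph_preimage:
  assumes sets: "set_of_universe U X" "set_of_universe U B" "set_of_universe U g" "E \<subseteq> X"
    and pre: "\<And>x y. x \<in> X \<Longrightarrow> y \<in> B \<Longrightarrow> opair U x y \<in> g \<Longrightarrow> x \<in> E"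
    and "x \<in> hyper U k X" "y \<in> hyper U k B" "opair U x y \<in> hyper U k g"
  shows "x \<in> hyper U k E"
proof -
  have "set_of_universe U E" using subsets sets by blast
  then have "sat U ((\<lambda>_. code X)(4 := code B, 5 := code g, 6 := code E))
    (FAll 0 3 (FAll 1 4 (FAll 2 5 (FImp (FPair 2 0 1) (FMem 0 6)))))"
    using pre by (simp add: mem_code sets)
  then show ?thesis
    using assms(6-8) by (subst (asm) transfer_iterated[where k = k]) (simp add: mem_hyper)
qed

end


section \<open>Types as ultrafilters\<close>

text \<open>The ultrafilter \<U> of \<alpha> as a HOL filter concentrated on the carrier, which
  gives access to \<open>eventually\<close> and \<open>filtermap\<close>.\<close>

definition type_filter :: "'u universe \<Rightarrow> 'u layered \<Rightarrow> 'u \<Rightarrow> 'u filter" where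
  "type_filter U P \<alpha> = Abs_filter (\<lambda>Q. \<alpha> \<in> hyper U 1 {x \<in> carrier P. Q x})"

locale universe_over = nonstandard_universe U
  for U :: "'u universe" +
  fixes P :: "'u layered"
  assumes set_carrier: "set_of_universe U (carrier P)"
    and star_carrier: "s \<in> carrier P \<Longrightarrow> star U s = s"
    and semigroup: "partial_semigroup P"
begin

lemma set_subcarrier [simp]: "A \<subseteq> carrier P \<Longrightarrow> set_of_universe U A"
  using subsets[OF set_carrier] .

lemma eventually_type_filter:
  assumes "\<alpha> \<in> hyper U 1 (carrier P)"
  shows "eventually Q (type_filter U P \<alpha>) \<longleftrightarrow> \<alpha> \<in> hyper U 1 {x \<in> carrier P. Q x}"
  unfolding type_filter_def
proof (rule eventually_Abs_filter, rule is_filter.intro)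
  show "\<alpha> \<in> hyper U 1 {x \<in> carrier P. True}"
    using assms by simp
  show "\<alpha> \<in> hyper U 1 {x \<in> carrier P. Q x \<and> R x}"
    if "\<alpha> \<in> hyper U 1 {x \<in> carrier P. Q x}" "\<alpha> \<in> hyper U 1 {x \<in> carrier P. R x}" for Q R
    using that hyper_Int_subset_Un[of "{x \<in> carrier P. Q x}" "{x \<in> carrier P. R x}"
        "{x \<in> carrier P. Q x \<and> R x}" "{x \<in> carrier P. Q x \<and> R x}" 1] by auto
  show "\<alpha> \<in> hyper U 1 {x \<in> carrier P. R x}"
    if "\<forall>x. Q x \<longrightarrow> R x" "\<alpha> \<in> hyper U 1 {x \<in> carrier P. Q x}" for Q R
    using that hyper_mono[of "{x \<in> carrier P. R x}" "{x \<in> carrier P. Q x}" 1] by auto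
qed

lemma type_filter_carrier:
  "\<alpha> \<in> hyper U 1 (carrier P) \<Longrightarrow> \<forall>\<^sub>F x in type_filter U P \<alpha>. x \<in> carrier P"
  by (simp add: eventually_type_filter)

lemma type_filter_nontrivial:
  "\<alpha> \<in> hyper U 1 (carrier P) \<Longrightarrow> type_filter U P \<alpha> \<noteq> bot"
  using eventually_type_filter[of \<alpha> "\<lambda>_. False"] hyper_empty[OF set_carrier]
  by (auto simp: trivial_limit_def)

lemma type_filter_ultra:
  assumes "\<alpha> \<in> hyper U 1 (carrier P)"
  shows "eventually Q (type_filter U P \<alpha>) \<or> (\<forall>\<^sub>F x in type_filter U P \<alpha>. \<not> Q x)"
  using assms hyper_Int_subset_Un[of "carrier P" "carrier P"
      "{x \<in> carrier P. Q x}" "{x \<in> carrier P. \<not> Q x}" 1]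
  by (auto simp: eventually_type_filter)

text \<open>Otherwise the ultrafilter would contain the complement of each of the finitely many
  colour classes, hence the empty set.\<close>

lemma type_filter_colour:
  assumes \<alpha>: "\<alpha> \<in> hyper U 1 (carrier P)" and "finite (c ` carrier P)"
  shows "\<exists>d. \<forall>\<^sub>F x in type_filter U P \<alpha>. c x = d"
proof (rule ccontr)
  assume "\<nexists>d. \<forall>\<^sub>F x in type_filter U P \<alpha>. c x = d"
  then have "\<forall>\<^sub>F x in type_filter U P \<alpha>. c x \<noteq> d" for d
    using type_filter_ultra[OF \<alpha>, of "\<lambda>x. c x = d"] by simp
  then have "\<forall>\<^sub>F x in type_filter U P \<alpha>. \<forall>d\<in>c ` carrier P. c x \<noteq> d"
    using assms(2) by (intro eventually_ball_finite) simp_all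
  then have "\<forall>\<^sub>F x in type_filter U P \<alpha>. False"
    using type_filter_carrier[OF \<alpha>] by eventually_elim auto
  then show False
    using type_filter_nontrivial[OF \<alpha>] by (simp add: trivial_limit_def)
qed

lemma type_filter_push:
  assumes f: "f \<in> carrier P \<rightarrow> carrier P"
    and \<alpha>: "\<alpha> \<in> hyper U 1 (carrier P)" and \<beta>: "\<beta> \<in> hyper U 1 (carrier P)"
    and sim: "sim U P 1 (hyper_map U P 1 f \<alpha>) 1 \<beta>"
  shows "filtermap f (type_filter U P \<alpha>) \<le> type_filter U P \<beta>"
proof (rule filter_leI)
  let ?S = "carrier P" and ?g = "map_graph U P f"
  fix Q assume "eventually Q (type_filter U P \<beta>)"
  then have "{x \<in> ?S. Q x} \<in> ultra U P 1 \<beta>"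
    using \<beta> by (simp add: eventually_type_filter ultra_def)
  then have Q: "hyper_map U P 1 f \<alpha> \<in> hyper U 1 {x \<in> ?S. Q x}"
    using sim by (auto simp: sim_def ultra_def)
  have sub: "?g \<subseteq> {opair U x y | x y. x \<in> ?S \<and> y \<in> ?S}"
    using f by (auto simp: map_graph_def)
  then have g: "set_of_universe U ?g"
    using subsets products set_carrier by blast
  \<comment> \<open>The starred graph is total and single-valued at \<alpha>, so the description in
    \<open>hyper_map\<close> denotes a genuine value.\<close>
  have "\<exists>y. opair U \<alpha> y \<in> hyper U 1 ?g"
  proof (rule hyper_graph_total[OF set_carrier set_carrier g _ \<alpha>])
    fix x assume "x \<in> ?S"
    then show "\<exists>y\<in>?S. opair U x y \<in> ?g"
      using f by (intro bexI[of _ "f x"]) (auto simp: map_graph_def)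
  qed
  moreover have "y = z" if "opair U \<alpha> y \<in> hyper U 1 ?g" "opair U \<alpha> z \<in> hyper U 1 ?g" for y z
    by (rule hyper_graph_functional[OF set_carrier set_carrier g sub _ that])
      (auto simp: map_graph_def)
  ultimately have "\<exists>!y. opair U \<alpha> y \<in> hyper U 1 ?g"
    by blast
  then have "opair U \<alpha> (hyper_map U P 1 f \<alpha>) \<in> hyper U 1 ?g"
    unfolding hyper_map_def by (rule theI')
  then have "\<alpha> \<in> hyper U 1 {x \<in> ?S. Q (f x)}"
    by (rule hyper_graph_preimage[OF set_carrier _ g _ _ \<alpha> Q, rotated -1]) (auto simp: map_graph_def)
  then show "eventually Q (filtermap f (type_filter U P \<alpha>))"
    using \<alpha> by (simp add: eventually_filtermap eventually_type_filter)
qed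

section \<open>Sums of types as convolutions\<close>

lemma add_graph_sets:
  defines "X \<equiv> {opair U x y | x y. x \<in> carrier P \<and> y \<in> carrier P}"
  shows "set_of_universe U X" "set_of_universe U (add_graph U P)"
    "add_graph U P \<subseteq> {opair U p z | p z. p \<in> X \<and> z \<in> carrier P}"
proof -
  show X: "set_of_universe U X"
    unfolding X_def by (intro products set_carrier)
  show sub: "add_graph U P \<subseteq> {opair U p z | p z. p \<in> X \<and> z \<in> carrier P}"
    using partial_semigroup_closed[OF semigroup] unfolding add_graph_def X_def by blast
  show "set_of_universe U (add_graph U P)"
    using subsets[OF products[OF X set_carrier] sub] .
qed

lemma hyper_addD:
  assumes "hyper_add U P k x y = Some \<sigma>"
  shows "opair U (opair U x y) \<sigma> \<in> hyper U k (add_graph U P)"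
proof -
  have "z = w" if "opair U (opair U x y) z \<in> hyper U k (add_graph U P)"
    "opair U (opair U x y) w \<in> hyper U k (add_graph U P)" for z w
    by (rule hyper_graph_functional[OF add_graph_sets(1) set_carrier add_graph_sets(2,3) _ that])
      (auto simp: add_graph_def)
  moreover obtain z where "opair U (opair U x y) z \<in> hyper U k (add_graph U P)"
    using assms by (auto simp: hyper_add_def split: if_splits)
  ultimately show ?thesis
    using assms unfolding hyper_add_def by (metis option.sel theI)
qed

text \<open>The sum \<alpha> + *\<beta> lies in **B, where \<open>B\<close> is given by
  \<open>Q\<close>. Its two stars are removed one at a time: first \<alpha> is replaced by a point
  \<open>x\<close> of the carrier, then \<beta> by a point \<open>y\<close>.\<close>

lemma type_filter_conv:
  assumes \<alpha>: "\<alpha> \<in> hyper U 1 (carrier P)" and \<beta>: "\<beta> \<in> hyper U 1 (carrier P)"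
    and \<gamma>: "\<gamma> \<in> hyper U 1 (carrier P)"
    and \<sigma>: "hyper_add U P 2 \<alpha> (star U \<beta>) = Some \<sigma>" "sim U P 2 \<sigma> 1 \<gamma>"
    and Q: "\<forall>\<^sub>F z in type_filter U P \<gamma>. Q z"
  shows "\<forall>\<^sub>F x in type_filter U P \<alpha>. \<forall>\<^sub>F y in type_filter U P \<beta>. \<exists>z. add P x y = Some z \<and> Q z"
proof -
  let ?S = "carrier P" and ?g = "add_graph U P"
  let ?X = "{opair U x y | x y. x \<in> ?S \<and> y \<in> ?S}"
  define B where "B = {z \<in> ?S. Q z}"
  \<comment> \<open>\<open>D\<close> collects the \<open>x\<close> with x + \<beta> \<in> *B, and
    \<open>E x\<close> the \<open>y\<close> with x + y \<in> B.\<close>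
  define E where "E x = {y \<in> ?S. \<exists>z. add P x y = Some z \<and> Q z}" for x
  define D where "D = {x \<in> ?S. \<exists>z \<in> hyper U 1 B. opair U (opair U x \<beta>) z \<in> hyper U 1 ?g}"
  have B: "set_of_universe U B" and D: "set_of_universe U D"
    and E: "set_of_universe U (E x)" for x
    by (auto simp: B_def D_def E_def)
  have sets: "set_of_universe U ?g" "set_of_universe U ?X"
    by (rule add_graph_sets)+
  have "B \<in> ultra U P 1 \<gamma>"
    using Q \<gamma> by (simp add: ultra_def B_def eventually_type_filter)
  then have \<sigma>B: "\<sigma> \<in> hyper U 2 B"
    using \<sigma>(2) by (auto simp: sim_def ultra_def)
  have \<sigma>g: "opair U (opair U \<alpha> (star U \<beta>)) \<sigma> \<in> hyper U 2 ?g"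
    using \<sigma>(1) by (rule hyper_addD)
  \<comment> \<open>The inner pair is quantified separately in the formula below, so it needs a
    bounding set.\<close>
  then have \<sigma>X: "opair U \<alpha> (star U \<beta>) \<in> hyper U 2 ?X"
    using hyper_graph_subset[OF sets(2) set_carrier sets(1) add_graph_sets(3)] by blast
  \<comment> \<open>Slots 5 to 7 carry one star already and slot 9 holds \<beta>. One more star
    gives **B, the twice starred graph and *\<beta>, while slot 4 (\<open>?S\<close> by default) and
    \<open>D\<close> receive their first star.\<close>
  have "sat U ((\<lambda>_. code ?S)(5 := star U (code B), 6 := star U (code ?g), 7 := star U (code ?X),
        8 := code D, 9 := \<beta>))
      (FAll 0 4 (FAll 1 5 (FAll 2 6 (FAll 3 7
        (FImp (FPair 3 0 9) (FImp (FPair 2 3 1) (FMem 0 8)))))))"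
    by (auto simp: mem_code set_carrier D) (auto simp: D_def mem_hyper)
  then have "\<alpha> \<in> hyper U 1 D"
    using \<alpha> \<sigma>B \<sigma>g \<sigma>X
    by (subst (asm) transfer_principle) (simp add: mem_hyper numeral_2_eq_2)
  also have "hyper U 1 D \<subseteq> hyper U 1 {x \<in> ?S. \<forall>\<^sub>F y in type_filter U P \<beta>. \<exists>z. add P x y = Some z \<and> Q z}"
  proof (intro hyper_mono set_subcarrier subsetI)
    show "x \<in> ?S" if "x \<in> {x \<in> ?S. \<forall>\<^sub>F y in type_filter U P \<beta>. \<exists>z. add P x y = Some z \<and> Q z}" for x
      using that by simp
  next
    fix x assume "x \<in> D"
    then obtain z where x: "x \<in> ?S" and z: "z \<in> hyper U 1 B" "opair U (opair U x \<beta>) z \<in> hyper U 1 ?g"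
      by (auto simp: D_def)
    have zX: "opair U x \<beta> \<in> hyper U 1 ?X"
      using hyper_graph_subset[OF sets(2) set_carrier sets(1) add_graph_sets(3) z(2)] by blast
    \<comment> \<open>Slot 9 now holds \<open>x\<close>, which the star fixes, and slot 0 the second
      summand, to be instantiated by \<beta>.\<close>
    have "sat U ((\<lambda>_. code ?S)(5 := code B, 6 := code ?g, 7 := code ?X, 8 := code (E x), 9 := x))
      (FAll 0 4 (FAll 1 5 (FAll 2 6 (FAll 3 7
        (FImp (FPair 3 9 0) (FImp (FPair 2 3 1) (FMem 0 8)))))))"
      by (auto simp: mem_code set_carrier B E sets)
        (auto simp: E_def B_def add_graph_def)
    then have "\<beta> \<in> hyper U 1 (E x)"
      using \<beta> z zX
      by (subst (asm) transfer_principle) (simp add: mem_hyper star_carrier[OF x])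
    then show "x \<in> {x \<in> ?S. \<forall>\<^sub>F y in type_filter U P \<beta>. \<exists>z. add P x y = Some z \<and> Q z}"
      using x \<beta> by (simp add: eventually_type_filter E_def)
  qed
  finally show ?thesis
    by (simp only: eventually_type_filter[OF \<alpha>])
qed

text \<open>Both sums in \<open>preceq\<close> have the type of \<alpha>, the first by way of the
  second, so \<open>type_filter_conv\<close> applies in either order.\<close>

lemma preceq_conv:
  assumes "\<alpha> \<in> hyper U 1 (carrier P)" "\<beta> \<in> hyper U 1 (carrier P)" "preceq U P \<alpha> \<beta>"
    and "\<forall>\<^sub>F z in type_filter U P \<alpha>. Q z"
  shows "\<forall>\<^sub>F x in type_filter U P \<alpha>. \<forall>\<^sub>F y in type_filter U P \<beta>. \<exists>z. add P x y = Some z \<and> Q z"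
    and "\<forall>\<^sub>F x in type_filter U P \<beta>. \<forall>\<^sub>F y in type_filter U P \<alpha>. \<exists>z. add P x y = Some z \<and> Q z"
proof -
  obtain \<sigma> \<tau> where \<sigma>: "hyper_add U P 2 \<alpha> (star U \<beta>) = Some \<sigma>" "sim U P 2 \<sigma> 1 \<alpha>"
    and \<tau>: "hyper_add U P 2 \<beta> (star U \<alpha>) = Some \<tau>" "sim U P 2 \<tau> 1 \<alpha>"
    using assms(3) by (auto simp: preceq_def sim_def)
  show "\<forall>\<^sub>F x in type_filter U P \<alpha>. \<forall>\<^sub>F y in type_filter U P \<beta>. \<exists>z. add P x y = Some z \<and> Q z"
    using assms(1,2,1) \<sigma> assms(4) by (rule type_filter_conv)
  show "\<forall>\<^sub>F x in type_filter U P \<beta>. \<forall>\<^sub>F y in type_filter U P \<alpha>. \<exists>z. add P x y = Some z \<and> Q z"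
    using assms(2,1,1) \<tau> assms(4) by (rule type_filter_conv)
qed

end

section \<open>From the Ramsey sequence to the block sequence\<close>

theorem theorem5p5:
  fixes U :: "'u universe" and P :: "'u layered" and \<delta> :: enat
    and F :: "('u \<Rightarrow> 'u) set" and n m :: nat and c :: "'u \<Rightarrow> 'c"
  assumes universe: "nonstandard_universe U"
    and carrier: "set_of_universe U (carrier P)" "\<forall>s\<in>carrier P. star U s = s"
    and saturated:
      "compact_space (topology_generated_by {hyper U 1 B | B. B \<subseteq> carrier P})"
    and adequate: "adequate_layered P \<delta>"
    and regressive: "\<forall>f\<in>F. regressive P f"
    and locally_finite: "locally_finite P F"
    and ramsey: "ramsey U P \<delta> F"
    and n: "enat n < \<delta>"
    and colouring: "finite (c ` carrier P)"
  shows "\<exists>xs. length xs = m \<and> set xs \<subseteq> layer P n \<and> block_sequence P F xs \<and>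
           (\<forall>k\<le>n. monochromatic c (layer P k \<inter> block_sums P F xs))"
proof -
  interpret universe_over U P
  proof (intro universe_over.intro universe_over_axioms.intro)
    show "nonstandard_universe U" by (rule universe)
    show "set_of_universe U (carrier P)" by (rule carrier(1))
    show "star U s = s" if "s \<in> carrier P" for s using carrier(2) that by (rule bspec)
    show "partial_semigroup P" using adequate unfolding adequate_layered_def by (rule conjunct1)
  qed
  obtain \<alpha> where \<alpha>: "\<alpha> \<in> PiS U P \<delta>" "ramsey_sequence U P \<delta> F \<alpha>"
    using ramsey by (auto simp: ramsey_def)
  define W where "W k = type_filter U P (\<alpha> k)" for k
  let ?A = "layers_upto P n"
  let ?G = "(\<lambda>f. restrict f ?A) ` F"
  have less: "enat k < \<delta>" if "k \<le> n" for k
    using n that by (meson enat_ord_simps(1) le_less_trans)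
  have layer: "\<alpha> k \<in> hyper U 1 (layer P k)" if "k \<le> n" for k
    using \<alpha>(1) less[OF that] by (auto simp: PiS_def gamma_def dest: PiE_mem)
  have hyper: "\<alpha> k \<in> hyper U 1 (carrier P)" if "k \<le> n" for k
    using layer[OF that] hyper_mono[OF set_carrier, of "layer P k" 1] by (auto simp: layer_def)
  have in_layer: "\<forall>\<^sub>F x in W k. x \<in> layer P k" if "k \<le> n" for k
    using layer[OF that] hyper[OF that]
    by (simp add: W_def eventually_type_filter layer_def)
  have F: "f x \<in> carrier P" if "f \<in> F" "x \<in> carrier P" for f x
    using regressive that by (auto simp: regressive_def)
  have sub: "layer P n \<subseteq> ?A"
    by (auto simp: layer_def layers_upto_def)
  have "\<exists>d. \<forall>\<^sub>F x in W k. c x = d" if "k \<le> n" for k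
    unfolding W_def using hyper[OF that] colouring by (rule type_filter_colour)
  then obtain d where d: "\<And>k. k \<le> n \<Longrightarrow> \<forall>\<^sub>F x in W k. c x = d k"
    by metis
  \<comment> \<open>The predicate includes membership in \<open>layer P k\<close>, so that the index
    \<open>k\<close>, and with it the colour \<open>d k\<close>, can be read off from the
    sum.\<close>
  have "\<exists>xs. length xs = m \<and> set xs \<subseteq> layer P n \<and>
    (\<forall>ys\<in>summands ?G xs. \<exists>k\<le>n. \<exists>s. list_sum P ys = Some s \<and> s \<in> layer P k \<and> c s = d k)"
  proof (rule block_sums_eventually[where W = W])
    show "partial_semigroup P" by (rule semigroup)
    show "finite ?G"
      using locally_finite by (simp add: locally_finite_def Setcompr_eq_image)
    show "g \<in> layer P n \<rightarrow> carrier P" if "g \<in> ?G" for g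
    proof
      fix x assume "x \<in> layer P n"
      then have "x \<in> ?A" "x \<in> carrier P"
        using sub by (auto simp: layer_def)
      then show "g x \<in> carrier P"
        using that F by auto
    qed
    show "W n \<noteq> bot"
      unfolding W_def using hyper by (intro type_filter_nontrivial) simp
    show "\<forall>\<^sub>F x in W n. x \<in> layer P n"
      using in_layer by simp
    show "\<forall>\<^sub>F x in W k. x \<in> layer P k \<and> c x = d k" if "k \<le> n" for k
      using in_layer[OF that] d[OF that] by (rule eventually_conj)
    show "\<exists>k\<le>n. filtermap g (W n) \<le> W k" if g: "g \<in> ?G" for g
    proof -
      obtain f where f: "f \<in> F" "g = restrict f ?A" using g by blast
      obtain k where k: "k \<le> n" "sim U P 1 (hyper_map U P 1 f (\<alpha> n)) 1 (\<alpha> k)"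
        using \<alpha>(2) n f(1) unfolding ramsey_sequence_def coherent_def by blast
      \<comment> \<open>\<open>W n\<close> is concentrated on layer \<open>n\<close>, inside
        \<open>?A\<close>, so \<open>f\<close> and its restriction have the same
        push-forward.\<close>
      have "\<forall>\<^sub>F x in W n. g x = f x"
        using in_layer[OF order_refl] by eventually_elim (use sub in \<open>auto simp: f(2)\<close>)
      then have "filtermap g (W n) = filtermap f (W n)"
        unfolding filter_eq_iff eventually_filtermap
        by (intro allI eventually_subst) (auto elim: eventually_mono)
      also have "\<dots> \<le> W k"
        unfolding W_def using F[OF f(1)] hyper k by (intro type_filter_push Pi_I) auto
      finally show ?thesis using k(1) by blast
    qed
    show "\<forall>\<^sub>F x in W i. \<forall>\<^sub>F y in W j. \<exists>z. add P x y = Some z \<and> Q z"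
      if "i \<le> n" "j \<le> n" "\<forall>\<^sub>F z in W (max i j). Q z" for i j Q
    \<comment> \<open>The Ramsey property compares the larger index with the smaller; the two halves
      of \<open>preceq_conv\<close> serve the two orders of summation.\<close>
    proof (cases "j \<le> i")
      case True
      then have "preceq U P (\<alpha> i) (\<alpha> j)"
        using \<alpha>(2) less[OF that(1)] by (simp add: ramsey_sequence_def)
      then show ?thesis
        using that True preceq_conv(1)[OF hyper hyper, of i j] by (simp add: W_def max_def)
    next
      case False
      then have "preceq U P (\<alpha> j) (\<alpha> i)"
        using \<alpha>(2) less[OF that(2)] by (simp add: ramsey_sequence_def)
      then show ?thesis
        using that False preceq_conv(2)[OF hyper hyper, of j i] by (simp add: W_def max_def)
    qed
  qed
  then obtain xs where xs: "length xs = m" "set xs \<subseteq> layer P n"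
    and sums: "\<And>ys. ys \<in> summands F xs \<Longrightarrow>
      \<exists>k. \<exists>s. list_sum P ys = Some s \<and> s \<in> layer P k \<and> c s = d k"
    using summands_restrict[of _ ?A F] sub by (metis (no_types, lifting) subset_iff)
  have "block_sequence P F xs"
    using xs(2) sums by (fastforce simp: block_sequence_def layer_def)
  \<comment> \<open>Layers are disjoint, so a sum lying in layer \<open>k\<close> can only have been
    obtained with index \<open>k\<close> and has colour \<open>d k\<close>.\<close>
  moreover have "monochromatic c (layer P k \<inter> block_sums P F xs)" for k
    unfolding monochromatic_def block_sums_def
    using sums by (intro exI[of _ "d k"]) (fastforce simp: layer_def)
  ultimately show ?thesis using xs by blast
qed

end
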